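(* Let $K$ be a field (of any characteristic), $d\ge2$, $\delta\in\{1,-1\}$, $f_t(x)=x^d+c_1(t)x^{d-1}+\dots+c_d(t)$ with $c_i\in K[t]$, and if $\delta=1$ assume $f_t(x)$ is an even polynomial in $x$ (i.e. $f_t(-x)=f_t(x)$ in $K[t,x]$). Let $H_t(x,y)=(\delta y+f_t(x),x)$ for $t\in\overline K$, and let $\mathbf P=(a(t),b(t))\in K[t]^2$, $P_t=(a(t),b(t))$, satisfy: $(\deg A_n)_{n\ge0}$ or $(\deg B_n)_{n\ge0}$ is unbounded, where $A_0=a$, $A_1=\delta b+f_t(a)$, $A_{n+1}=\delta A_{n-1}+f_t(A_n)$, $B_0=b$, $B_1=\delta^{-1}(a-f_t(b))$, $B_{n+1}=\delta^{-1}(B_{n-1}-f_t(B_n))$. If $\delta a(t)+b(t)=0$ in $K[t]$, then $\Sigma(\mathbf P):=\{t\in\mathbb A^1(\overline K)\mid P_t\text{ is periodic for }H_t\}$ is infinite.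
   Context: A point $P$ is periodic for $H_t$ if $H_t^n(P)=P$ for some $n\ge1$. *)

theory Defs
  imports "HOL-Algebra.Algebraic_Closure_Type"
begin

text \<open>
  An element of $K[t]$ is a value of type \<^typ>\<open>'a poly\<close>; an element of $K[t,x] = K[t][x]$ is
  a value of type \<^typ>\<open>'a poly poly\<close>, the outer variable being $x$ and the inner one $t$.
  The algebraic closure of $K$ is \<^typ>\<open>'a alg_closure\<close>, with embedding \<^const>\<open>to_ac\<close>.
  Names such as \<open>Polynomial.monom\<close> are qualified because HOL-Algebra has constants of the
  same base name.
\<close>

text \<open>$f_t(x) = x^d + c_1(t) x^{d-1} + \dots + c_d(t)$; only $c_1, \dots, c_d$ are used.\<close>

definition family_poly :: "nat \<Rightarrow> (nat \<Rightarrow> 'a::field poly) \<Rightarrow> 'a poly poly" where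
  "family_poly d c = Polynomial.monom 1 d + (\<Sum>i=1..d. Polynomial.monom (c i) (d - i))"

definition eval_ac :: "'a::field poly \<Rightarrow> 'a alg_closure \<Rightarrow> 'a alg_closure" where
  "eval_ac p t = poly (map_poly to_ac p) t"

definition specialize :: "'a::field poly poly \<Rightarrow> 'a alg_closure \<Rightarrow> 'a alg_closure poly" where
  "specialize f t = map_poly (\<lambda>p. eval_ac p t) f"

definition henon ::
  "'a::field \<Rightarrow> 'a poly poly \<Rightarrow> 'a alg_closure \<Rightarrow>
     'a alg_closure \<times> 'a alg_closure \<Rightarrow> 'a alg_closure \<times> 'a alg_closure" where
  "henon \<delta> f t = (\<lambda>(x, y). (to_ac \<delta> * y + poly (specialize f t) x, x))"

definition is_periodic_point :: "('b \<Rightarrow> 'b) \<Rightarrow> 'b \<Rightarrow> bool" where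
  "is_periodic_point h P \<longleftrightarrow> (\<exists>n\<ge>1. (h ^^ n) P = P)"

definition periodic_parameters ::
  "'a::field \<Rightarrow> 'a poly poly \<Rightarrow> 'a poly \<Rightarrow> 'a poly \<Rightarrow> 'a alg_closure set" where
  "periodic_parameters \<delta> f a b =
     {t. is_periodic_point (henon \<delta> f t) (eval_ac a t, eval_ac b t)}"

fun forward_seq :: "'a::field \<Rightarrow> 'a poly poly \<Rightarrow> 'a poly \<Rightarrow> 'a poly \<Rightarrow> nat \<Rightarrow> 'a poly" where
  "forward_seq \<delta> f a b 0 = a"
| "forward_seq \<delta> f a b (Suc 0) = smult \<delta> b + poly f a"
| "forward_seq \<delta> f a b (Suc (Suc n)) =
     smult \<delta> (forward_seq \<delta> f a b n) + poly f (forward_seq \<delta> f a b (Suc n))"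

fun backward_seq :: "'a::field \<Rightarrow> 'a poly poly \<Rightarrow> 'a poly \<Rightarrow> 'a poly \<Rightarrow> nat \<Rightarrow> 'a poly" where
  "backward_seq \<delta> f a b 0 = b"
| "backward_seq \<delta> f a b (Suc 0) = smult (inverse \<delta>) (a - poly f b)"
| "backward_seq \<delta> f a b (Suc (Suc n)) =
     smult (inverse \<delta>) (backward_seq \<delta> f a b n - poly f (backward_seq \<delta> f a b (Suc n)))"

end

theory Submission
  imports Defs
begin

text \<open>
  The involution \<open>\<sigma>(x, y) = (-\<delta> y, -\<delta> x)\<close> conjugates \<open>H\<close> to its inverse and, since
  \<open>\<delta> a + b = 0\<close>, fixes \<open>P\<close>. Hence \<open>H\<^sup>n P\<close> is fixed by \<open>\<sigma>\<close> if and only if \<open>H\<^sup>2\<^sup>n P = P\<close>, and this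
  remains true modulo any ideal of \<open>K[t]\<close>. The condition says that the ideal contains
  \<open>G\<^sub>n = A\<^sub>n + \<delta> A\<^sub>n\<^sub>-\<^sub>1\<close>, so every root of \<open>G\<^sub>n\<close> with \<open>n \<ge> 1\<close> is a periodic parameter.
  Now let \<open>u\<close> be a periodic parameter, and \<open>q\<close> the least power of \<open>t - u\<close> that does not divide \<open>G\<^sub>1\<close>. If \<open>q\<close>
  divides some \<open>G\<^sub>r\<close>, then \<open>P\<close> is periodic modulo \<open>q\<close>, and therefore \<open>q\<close> does not divide
  \<open>G\<^bsub>1 + k r\<^esub>\<close> either. If there were only finitely many periodic parameters, a common multiple
  \<open>R\<close> of the numbers \<open>r\<close> would give \<open>G\<^bsub>1 + k R\<^esub> dvd G\<^sub>1\<close> for all \<open>k\<close>, although the degrees of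
  the \<open>G\<^sub>n\<close> tend to infinity.
\<close>

section \<open>Reversible maps\<close>

text \<open>\<open>reversal\<close> says that \<open>s\<close> conjugates \<open>h\<close> to its
  inverse without naming an inverse. \<open>E\<close> stands for equality modulo an ideal;
  \<open>E_map_iff\<close> lets iterates of \<open>h\<close> be cancelled modulo
  \<open>E\<close>.\<close>

locale reversible_map =
  fixes h s :: "'b \<Rightarrow> 'b" and E :: "'b \<Rightarrow> 'b \<Rightarrow> bool" and P :: 'b
  assumes equiv: "equivp E"
    and E_map_iff: "E (h x) (h y) \<longleftrightarrow> E x y"
    and reversal: "h (s (h z)) = s z"
    and base_fixed: "s P = P"
begin

definition symmetric_at :: "nat \<Rightarrow> bool" where
  "symmetric_at n \<longleftrightarrow> E ((h ^^ n) P) (s ((h ^^ n) P))"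

lemma E_funpow_iff: "E ((h ^^ n) x) ((h ^^ n) y) \<longleftrightarrow> E x y"
  by (induction n) (simp_all add: E_map_iff)

lemma reversal_funpow: "(h ^^ n) (s ((h ^^ n) z)) = s z"
proof (induction n)
  case (Suc n)
  have "(h ^^ Suc n) (s ((h ^^ Suc n) z)) = (h ^^ n) (h (s (h ((h ^^ n) z))))"
    by (simp add: funpow_swap1)
  then show ?case using Suc by (simp add: reversal)
qed simp

text \<open>Apply \<open>h ^^ n\<close> to both sides of the symmetry relation: by reversal the
  right side collapses to \<open>s P = P\<close>, and cancellation makes the step
  reversible.\<close>

lemma symmetric_at_iff_periodic: "symmetric_at n \<longleftrightarrow> E ((h ^^ (2 * n)) P) P"
proof -
  have "symmetric_at n \<longleftrightarrow> E ((h ^^ n) ((h ^^ n) P)) ((h ^^ n) (s ((h ^^ n) P)))"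
    unfolding symmetric_at_def by (simp add: E_funpow_iff)
  also have "\<dots> \<longleftrightarrow> E ((h ^^ (2 * n)) P) P"
    by (simp add: reversal_funpow base_fixed mult_2 funpow_add)
  finally show ?thesis .
qed

lemma E_funpow_multiple:
  assumes "E ((h ^^ r) P) P"
  shows "E ((h ^^ (k * r)) P) P"
proof (induction k)
  case 0
  then show ?case using equiv by (simp add: equivp_reflp)
next
  case (Suc k)
  have "E ((h ^^ r) ((h ^^ (k * r)) P)) ((h ^^ r) P)"
    using Suc by (simp add: E_funpow_iff)
  then show ?case using assms equiv by (auto simp: funpow_add intro: equivp_transp)
qed

text \<open>Symmetry at \<open>r\<close> makes \<open>2 * r\<close> a period modulo
  \<open>E\<close>, and moving \<open>m\<close> by \<open>k * r\<close> moves \<open>2 * m\<close>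
  by a multiple of that period.\<close>

lemma symmetric_at_shift:
  assumes "symmetric_at r"
  shows "symmetric_at (m + k * r) \<longleftrightarrow> symmetric_at m"
proof -
  have "E ((h ^^ (k * (2 * r))) P) P"
    using assms by (rule E_funpow_multiple[OF symmetric_at_iff_periodic[THEN iffD1]])
  then have "E ((h ^^ (2 * m)) ((h ^^ (k * (2 * r))) P)) ((h ^^ (2 * m)) P)"
    by (simp add: E_funpow_iff)
  moreover have "(h ^^ (2 * m)) ((h ^^ (k * (2 * r))) P) = (h ^^ (2 * (m + k * r))) P"
  proof -
    have "2 * (m + k * r) = 2 * m + k * (2 * r)" by simp
    then show ?thesis by (simp only: funpow_add comp_apply)
  qed
  ultimately show ?thesis
    unfolding symmetric_at_iff_periodic using equiv by (metis equivp_symp equivp_transp)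
qed

text \<open>A positive symmetric time serves as \<open>r\<close>. If there is none,
  \<open>r = 1\<close> works: \<open>m + k\<close> is either positive or equal to
  \<open>m\<close>.\<close>

lemma not_symmetric_progression:
  assumes "\<not> symmetric_at m"
  shows "\<exists>r>0. \<forall>k. \<not> symmetric_at (m + k * r)"
proof (cases "\<exists>r>0. symmetric_at r")
  case True
  then show ?thesis using assms symmetric_at_shift by blast
next
  case False
  have "\<not> symmetric_at (m + k)" for k
    using False assms by (metis add_is_0 gr0I)
  then show ?thesis by (intro exI[of _ 1]) simp
qed

end


section \<open>Henon maps over a commutative ring\<close>

text \<open>Over an arbitrary ring, so that the orbit can be iterated in K[t] itself and then
  reduced modulo ideals.\<close>

definition henon_map :: "'r::comm_ring_1 \<Rightarrow> ('r \<Rightarrow> 'r) \<Rightarrow> 'r \<times> 'r \<Rightarrow> 'r \<times> 'r" where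
  "henon_map \<delta> F = (\<lambda>(x, y). (\<delta> * y + F x, x))"

definition skew_swap :: "'r::comm_ring_1 \<Rightarrow> 'r \<times> 'r \<Rightarrow> 'r \<times> 'r" where
  "skew_swap \<delta> = (\<lambda>(x, y). (- \<delta> * y, - \<delta> * x))"

definition pair_cong :: "'r::comm_ring_1 set \<Rightarrow> 'r \<times> 'r \<Rightarrow> 'r \<times> 'r \<Rightarrow> bool" where
  "pair_cong I z w \<longleftrightarrow> fst z - fst w \<in> I \<and> snd z - snd w \<in> I"

text \<open>For \<open>\<delta>\<^sup>2 = 1\<close> the two coordinates of \<open>z - skew_swap \<delta> z\<close> are \<open>symm_defect \<delta> z\<close> and
  \<open>\<delta>\<close> times it, so one equation describes the fixed points, modulo any ideal.\<close>

definition symm_defect :: "'r::comm_ring_1 \<Rightarrow> 'r \<times> 'r \<Rightarrow> 'r" where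
  "symm_defect \<delta> z = fst z + \<delta> * snd z"

lemma henon_map_reversible:
  fixes \<delta> :: "'r::comm_ring_1"
  assumes zero: "0 \<in> I"
    and add: "\<And>x y. x \<in> I \<Longrightarrow> y \<in> I \<Longrightarrow> x + y \<in> I"
    and mult: "\<And>r x. x \<in> I \<Longrightarrow> r * x \<in> I"
    and unit: "\<delta> * \<delta> = 1"
    and dvd: "\<And>x y. x - y dvd F x - F y"
    and even: "\<And>x. F (- \<delta> * x) = F x"
    and base: "symm_defect \<delta> P = 0"
  shows "reversible_map (henon_map \<delta> F) (skew_swap \<delta>) (pair_cong I) P"
proof
  have uminus: "- x \<in> I" if "x \<in> I" for x
    using mult[of x "-1"] that by simp
  have diff: "x - y \<in> I" if "x \<in> I" "y \<in> I" for x y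
    using add[of x "- y"] uminus that by simp
  show "equivp (pair_cong I)"
  proof (rule equivpI)
    show "reflp (pair_cong I)"
      by (simp add: reflp_def pair_cong_def zero)
    show "symp (pair_cong I)"
      unfolding symp_def pair_cong_def by (metis minus_diff_eq uminus)
    show "transp (pair_cong I)"
      unfolding transp_def pair_cong_def by (metis add diff_add_cancel add_diff_eq)
  qed
  show "pair_cong I (henon_map \<delta> F z) (henon_map \<delta> F w) \<longleftrightarrow> pair_cong I z w" for z w
  proof -
    obtain x y where z: "z = (x, y)" by force
    obtain x' y' where w: "w = (x', y')" by force
    have "\<delta> * y + F x - (\<delta> * y' + F x') \<in> I \<longleftrightarrow> y - y' \<in> I" if "x - x' \<in> I"
    proof -
      have "x - x' dvd F x - F x'" by (rule dvd)
      then obtain k where "F x - F x' = (x - x') * k" by (elim dvdE)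
      then have F: "F x - F x' \<in> I"
        using mult[OF that, of k] by (simp add: mult.commute)
      have split: "\<delta> * y + F x - (\<delta> * y' + F x') = \<delta> * (y - y') + (F x - F x')"
        by (simp add: algebra_simps)
      show ?thesis
      proof
        assume "\<delta> * y + F x - (\<delta> * y' + F x') \<in> I"
        then have "\<delta> * (y - y') \<in> I"
          using diff[OF _ F] unfolding split by fastforce
        \<comment> \<open>Multiplying once more by the unit \<open>\<delta>\<close> cancels
          it.\<close>
        then have "\<delta> * (\<delta> * (y - y')) \<in> I" by (rule mult)
        then show "y - y' \<in> I" by (simp add: mult.assoc[symmetric] unit)
      next
        assume "y - y' \<in> I"
        then show "\<delta> * y + F x - (\<delta> * y' + F x') \<in> I"
          unfolding split by (intro add mult F)
      qed
    qed
    then show ?thesis by (auto simp: z w henon_map_def pair_cong_def)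
  qed
  show "henon_map \<delta> F (skew_swap \<delta> (henon_map \<delta> F z)) = skew_swap \<delta> z" for z
  proof -
    obtain x y where z: "z = (x, y)" by force
    have "\<delta> * (- \<delta> * (\<delta> * y + F x)) = - (\<delta> * \<delta> * (\<delta> * y + F x))"
      by (simp add: mult.assoc)
    then have "\<delta> * (- \<delta> * (\<delta> * y + F x)) + F (- \<delta> * x) = - \<delta> * y"
      unfolding even unit by simp
    then show ?thesis by (simp add: z henon_map_def skew_swap_def)
  qed
  show "skew_swap \<delta> P = P"
  proof -
    obtain x y where P: "P = (x, y)" by force
    have x: "x = - \<delta> * y" using base by (simp add: P symm_defect_def eq_neg_iff_add_eq_0)
    have "- \<delta> * x = (\<delta> * \<delta>) * y" unfolding x by (simp add: mult.assoc)
    then show ?thesis using x by (simp add: P skew_swap_def unit)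
  qed
qed

lemma pair_cong_skew_swap_iff:
  assumes mult: "\<And>r x. x \<in> I \<Longrightarrow> r * x \<in> I" and unit: "\<delta> * \<delta> = (1::'r::comm_ring_1)"
  shows "pair_cong I z (skew_swap \<delta> z) \<longleftrightarrow> symm_defect \<delta> z \<in> I"
proof -
  obtain x y where z: "z = (x, y)" by force
  have "\<delta> * (x + \<delta> * y) = y + \<delta> * x"
    by (simp add: distrib_left mult.assoc[symmetric] unit)
  then show ?thesis
    using mult[of "x + \<delta> * y" \<delta>] by (auto simp: z pair_cong_def skew_swap_def symm_defect_def)
qed


section \<open>Polynomials and ring homomorphisms\<close>

lemma poly_map_poly_hom:
  assumes "h 0 = 0" "\<And>x y. h (x + y) = h x + h y" "\<And>x y. h (x * y) = h x * h y"
  shows "poly (map_poly h p) (h x) = h (poly p x)"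
  by (induction p) (simp_all add: assms map_poly_pCons)

lemma map_poly_to_ac_add: "map_poly to_ac (p + q) = map_poly to_ac p + map_poly to_ac q"
  by (rule poly_eqI) (simp add: coeff_map_poly)

lemma map_poly_to_ac_mult: "map_poly to_ac (p * q) = map_poly to_ac p * map_poly to_ac q"
  by (rule poly_eqI) (simp add: coeff_map_poly coeff_mult to_ac_sum)

lemma eval_ac_simps:
  "eval_ac 0 t = 0" "eval_ac (p + q) t = eval_ac p t + eval_ac q t"
  "eval_ac (p * q) t = eval_ac p t * eval_ac q t" "eval_ac [:k:] t = to_ac k"
  by (simp_all add: eval_ac_def map_poly_to_ac_add map_poly_to_ac_mult map_poly_pCons)

lemma eval_ac_poly: "eval_ac (poly f p) t = poly (specialize f t) (eval_ac p t)"
  unfolding specialize_def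
  by (rule poly_map_poly_hom[symmetric]) (simp_all add: eval_ac_simps)

lemma henon_eval_ac:
  "henon \<delta> f t (map_prod (\<lambda>p. eval_ac p t) (\<lambda>p. eval_ac p t) z) =
     map_prod (\<lambda>p. eval_ac p t) (\<lambda>p. eval_ac p t) (henon_map [:\<delta>:] (poly f) z)"
  by (cases z) (simp add: henon_def henon_map_def eval_ac_simps eval_ac_poly del: mult_pCons_left)

lemma henon_funpow_eval_ac:
  "(henon \<delta> f t ^^ n) (map_prod (\<lambda>p. eval_ac p t) (\<lambda>p. eval_ac p t) z) =
     map_prod (\<lambda>p. eval_ac p t) (\<lambda>p. eval_ac p t) ((henon_map [:\<delta>:] (poly f) ^^ n) z)"
  by (induction n) (simp_all add: henon_eval_ac)

lemma diff_dvd_poly_diff: "x - y dvd poly p x - poly p (y :: 'r::comm_ring_1)"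
proof (induction p)
  case (pCons k p)
  have "poly (pCons k p) x - poly (pCons k p) y = (x - y) * poly p x + y * (poly p x - poly p y)"
    by (simp add: algebra_simps)
  then show ?case using pCons by simp
qed simp

lemma size_proots_alg_closed: "size (proots p) = Polynomial.degree (p :: 'k::alg_closed_field poly)"
proof (cases "p = 0")
  case False
  then obtain A where A: "size A = Polynomial.degree p"
    "p = smult (lead_coeff p) (\<Prod>x\<in>#A. [:-x, 1:])"
    using alg_closed_imp_factorization by blast
  have "(\<Prod>x\<in>#B. [:-x, 1:]) \<noteq> 0" for B :: "'k multiset"
    by (auto simp: prod_mset_zero_iff)
  then have "proots (\<Prod>x\<in>#A. [:-x, 1:]) = A"
    by (induction A) (simp_all add: proots_mult del: mult_pCons_left)
  then have "proots p = A"
    using False by (subst A(2)) simp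
  then show ?thesis using A by simp
qed simp

text \<open>Over an algebraically closed field the degree counts the roots with multiplicity, so
  comparing orders amounts to an inclusion of root multisets.\<close>

lemma degree_le_if_order_le:
  fixes p q :: "'k::alg_closed_field poly"
  assumes "p \<noteq> 0" "q \<noteq> 0" "\<And>u. order u p \<le> order u q"
  shows "Polynomial.degree p \<le> Polynomial.degree q"
proof -
  have "proots p \<subseteq># proots q"
    using assms by (intro mset_subset_eqI) simp
  then show ?thesis
    using size_mset_mono by (metis size_proots_alg_closed)
qed


section \<open>Degree growth\<close>

text \<open>Once \<open>p\<close> has larger degree than every coefficient, the term
  \<open>p ^ d\<close> strictly dominates all others.\<close>

lemma degree_poly_family_poly:
  assumes "d \<ge> 1" and large: "Polynomial.degree p > (\<Sum>i=1..d. Polynomial.degree (c i))"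
  shows "Polynomial.degree (poly (family_poly d c) p) = d * Polynomial.degree p"
proof -
  have "p \<noteq> 0" using large by auto
  have eq: "poly (family_poly d c) p = p ^ d + (\<Sum>i=1..d. c i * p ^ (d - i))"
    by (simp add: family_poly_def poly_sum poly_monom)
  have lower: "Polynomial.degree (c i * p ^ (d - i)) < d * Polynomial.degree p" if "i \<in> {1..d}" for i
  proof -
    have "Polynomial.degree (c i * p ^ (d - i)) \<le>
        Polynomial.degree (c i) + (d - i) * Polynomial.degree p"
      using degree_mult_le[of "c i" "p ^ (d - i)"] \<open>p \<noteq> 0\<close> by (simp add: degree_power_eq)
    moreover have "Polynomial.degree (c i) < Polynomial.degree p"
      using large member_le_sum[OF that, of "\<lambda>i. Polynomial.degree (c i)"] by simp
    moreover have "Polynomial.degree p + (d - i) * Polynomial.degree p \<le> d * Polynomial.degree p"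
      using that mult_le_mono1[of "1 + (d - i)" d "Polynomial.degree p"] by auto
    ultimately show ?thesis by linarith
  qed
  have "Polynomial.degree (\<Sum>i=1..d. c i * p ^ (d - i)) < d * Polynomial.degree p"
    using assms by (intro degree_sum_less lower) auto
  then show ?thesis
    unfolding eq using \<open>p \<noteq> 0\<close> by (subst degree_add_eq_left) (simp_all add: degree_power_eq)
qed

lemma forward_seq_degree_increasing:
  assumes d: "d \<ge> 2"
    and f: "f = family_poly d c"
    and unbounded: "\<not> bdd_above (range (\<lambda>n. Polynomial.degree (forward_seq \<delta> f a b n)))"
  shows "\<exists>N. \<forall>n\<ge>N. Polynomial.degree (forward_seq \<delta> f a b n) <
    Polynomial.degree (forward_seq \<delta> f a b (Suc n))"
proof -
  define A where "A = forward_seq \<delta> f a b"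
  define deg where "deg n = Polynomial.degree (A n)" for n
  define M where "M = (\<Sum>i=1..d. Polynomial.degree (c i))"
  \<comment> \<open>The first index with degree above \<open>L\<close> is positive, and its
    predecessor has degree at most \<open>L\<close>. This strict jump starts the induction;
    multiplication of the degree by \<open>d\<close> continues it.\<close>
  define L where "L = max M (deg 0)"
  have "\<exists>n. deg n > L"
    using unbounded unfolding bdd_above_def deg_def A_def by (auto simp: not_le)
  then obtain m where m: "deg m > L" and least: "\<And>n. n < m \<Longrightarrow> \<not> deg n > L"
    using exists_least_iff[of "\<lambda>n. deg n > L"] by blast
  obtain N where N: "m = Suc N"
    using m by (cases m) (auto simp: L_def)
  have step: "deg (Suc n) > deg n \<and> deg (Suc n) > M" if "n \<ge> N" for n
    using that
  proof (induction n rule: dec_induct)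
    case base
    have "deg N \<le> L" using least[of N] by (simp add: N not_less)
    moreover have "M \<le> L" by (simp add: L_def)
    ultimately show ?case using m by (simp add: N)
  next
    case (step n)
    have "Polynomial.degree (poly f (A (Suc n))) = d * deg (Suc n)"
      unfolding f deg_def using step.IH d
      by (intro degree_poly_family_poly) (auto simp: M_def deg_def)
    moreover have less: "deg (Suc n) < d * deg (Suc n)"
      using d step.IH mult_less_mono1[of 1 d "deg (Suc n)"] by simp
    moreover have "Polynomial.degree (smult \<delta> (A n)) \<le> deg n"
      by (simp add: deg_def degree_smult_le)
    ultimately have "Polynomial.degree (smult \<delta> (A n) + poly f (A (Suc n))) = d * deg (Suc n)"
      using step.IH by (subst degree_add_eq_right) linarith+
    then have "deg (Suc (Suc n)) = d * deg (Suc n)"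
      by (simp add: deg_def A_def)
    then show ?case using less step.IH by linarith
  qed
  then show ?thesis unfolding deg_def A_def by blast
qed

text \<open>The reversing involution fixes P, so it carries the forward orbit to the backward one.
  Unboundedness of either degree sequence thus gives that of the other.\<close>

lemma backward_seq_eq:
  assumes "\<delta> * \<delta> = 1" and even: "\<And>p. poly f (smult (- \<delta>) p) = poly f p"
    and base: "smult \<delta> a + b = 0"
  shows "backward_seq \<delta> f a b n = smult (- \<delta>) (forward_seq \<delta> f a b n)"
proof -
  have inv: "inverse \<delta> = \<delta>" using assms(1) by (rule inverse_unique)
  have b: "b = smult (- \<delta>) a" using base by (simp add: eq_neg_iff_add_eq_0 add.commute)
  show ?thesis
  proof (induction n rule: induct_nat_012)
    case 0
    show ?case using b by simp
  next
    case 1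
    show ?case using even[of a] assms(1)
      by (simp add: inv b smult_diff_right smult_add_right)
  next
    case (ge2 n)
    then show ?case using even[of "forward_seq \<delta> f a b (Suc n)"] assms(1)
      by (simp add: inv smult_diff_right smult_add_right)
  qed
qed


section \<open>Infinitude of the periodic parameters\<close>

lemma forward_seq_eq_henon_map:
  "(henon_map [:\<delta>:] (poly f) ^^ Suc n) (a, b) =
     (forward_seq \<delta> f a b (Suc n), forward_seq \<delta> f a b n)"
  by (induction n) (simp_all add: henon_map_def)

theorem theorem5p1:
  fixes d :: nat
    and \<delta> :: "'a::field"
    and c :: "nat \<Rightarrow> 'a poly"
    and f :: "'a poly poly"
    and a b :: "'a poly"
  assumes "d \<ge> 2"
    and "\<delta> \<in> {1, -1}"
    and "f = family_poly d c"
    and "\<delta> = 1 \<Longrightarrow> f \<circ>\<^sub>p [:0, -1:] = f"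
    and "\<not> bdd_above (range (\<lambda>n. Polynomial.degree (forward_seq \<delta> f a b n)))
       \<or> \<not> bdd_above (range (\<lambda>n. Polynomial.degree (backward_seq \<delta> f a b n)))"
    and "smult \<delta> a + b = 0"
  shows "infinite (periodic_parameters \<delta> f a b)"
proof
  assume fin: "finite (periodic_parameters \<delta> f a b)"
  define A where "A = forward_seq \<delta> f a b"
  define G where "G n = symm_defect [:\<delta>:] ((henon_map [:\<delta>:] (poly f) ^^ n) (a, b))" for n
  define g where "g n = map_poly to_ac (G n)" for n
  have unit: "\<delta> * \<delta> = 1" using assms(2) by auto
  \<comment> \<open>For \<open>\<delta> = -1\<close> the substitution is the identity.\<close>
  have even: "poly f (smult (- \<delta>) p) = poly f p" for p
  proof (cases "\<delta> = 1")
    case True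
    have "poly (f \<circ>\<^sub>p [:0, -1:]) p = poly f p" by (simp only: assms(4)[OF True])
    then show ?thesis using True by (simp add: poly_pcompose)
  qed (use assms(2) in auto)
  have b: "b = - smult \<delta> a" using assms(6) by (simp add: eq_neg_iff_add_eq_0 add.commute)

  have "Polynomial.degree (backward_seq \<delta> f a b n) = Polynomial.degree (forward_seq \<delta> f a b n)" for n
    using unit by (auto simp: backward_seq_eq[OF unit even assms(6)])
  then have "\<not> bdd_above (range (\<lambda>n. Polynomial.degree (forward_seq \<delta> f a b n)))"
    using assms(5) by simp
  from forward_seq_degree_increasing[OF assms(1,3) this] obtain N where N: "\<And>n. n \<ge> N \<Longrightarrow> Polynomial.degree (A n) < Polynomial.degree (A (Suc n))"
    unfolding A_def by blast
  have G_Suc: "G (Suc n) = A (Suc n) + smult \<delta> (A n)" for n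
    unfolding G_def forward_seq_eq_henon_map A_def by (simp add: symm_defect_def)
  have deg_A: "n - N \<le> Polynomial.degree (A n)" if "n \<ge> N" for n
    using that
  proof (induction n rule: dec_induct)
    case (step n)
    then show ?case using N[of n] by linarith
  qed simp
  have deg_G: "Suc n - N \<le> Polynomial.degree (G (Suc n))" if "n \<ge> N" for n
  proof -
    have "Polynomial.degree (G (Suc n)) = Polynomial.degree (A (Suc n))"
      unfolding G_Suc using N[OF that] degree_smult_le[of \<delta> "A n"]
      by (intro degree_add_eq_left) linarith
    then show ?thesis using deg_A[of "Suc n"] that by simp
  qed
  have deg_g: "Polynomial.degree (g n) = Polynomial.degree (G n)" for n
    unfolding g_def by (rule degree_map_poly) simp

  \<comment> \<open>The contraction to K[t] of the ideal generated by \<open>q\<close> over the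
    closure: the orbit stays over K while multiplicities at any \<open>u\<close> can be
    tested.\<close>
  define I where "I q = {p :: 'a poly. q dvd map_poly to_ac p}" for q
  have reversible: "reversible_map (henon_map [:\<delta>:] (poly f)) (skew_swap [:\<delta>:])
      (pair_cong (I q)) (a, b)" for q
    by (rule henon_map_reversible)
      (use even unit in \<open>simp_all add: I_def map_poly_to_ac_add map_poly_to_ac_mult
        diff_dvd_poly_diff symm_defect_def b one_pCons\<close>)
  have symmetric_iff: "reversible_map.symmetric_at (henon_map [:\<delta>:] (poly f))
      (skew_swap [:\<delta>:]) (pair_cong (I q)) (a, b) n \<longleftrightarrow> q dvd g n" for q n
  proof -
    have "pair_cong (I q) z (skew_swap [:\<delta>:] z) \<longleftrightarrow> symm_defect [:\<delta>:] z \<in> I q" for z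
      by (rule pair_cong_skew_swap_iff)
        (simp_all add: I_def map_poly_to_ac_mult unit one_pCons)
    then show ?thesis
      unfolding reversible_map.symmetric_at_def[OF reversible] by (simp add: G_def g_def I_def)
  qed
  have progression: "\<exists>r>0. \<forall>k. \<not> q dvd g (m + k * r)" if "\<not> q dvd g m" for q m
    using reversible_map.not_symmetric_progression[OF reversible] that
    unfolding symmetric_iff by blast

  have root_periodic: "u \<in> periodic_parameters \<delta> f a b" if "poly (g n) u = 0" "n \<ge> 1" for n u
  proof -
    have "[:- u, 1:] dvd g n" using that by (simp add: poly_eq_0_iff_dvd)
    then have "pair_cong (I [:- u, 1:]) ((henon_map [:\<delta>:] (poly f) ^^ (2 * n)) (a, b)) (a, b)"
      using reversible_map.symmetric_at_iff_periodic[OF reversible] unfolding symmetric_iff by blast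
    moreover have "p - p' \<in> I [:- u, 1:] \<longleftrightarrow> eval_ac p u = eval_ac p' u" for p p'
    proof -
      have "eval_ac p u = eval_ac (p - p') u + eval_ac p' u"
        by (simp flip: eval_ac_simps)
      then show ?thesis by (auto simp: I_def eval_ac_def simp flip: poly_eq_0_iff_dvd)
    qed
    ultimately have "(henon \<delta> f u ^^ (2 * n)) (eval_ac a u, eval_ac b u) = (eval_ac a u, eval_ac b u)"
      using henon_funpow_eval_ac[of "2 * n" \<delta> f u "(a, b)"]
      by (simp add: pair_cong_def prod_eq_iff)
    then show ?thesis
      using that(2) unfolding periodic_parameters_def is_periodic_point_def
      by (intro CollectI exI[of _ "2 * n"]) simp
  qed

  \<comment> \<open>Modulo \<open>0\<close> congruence is equality, so \<open>g 1 = 0\<close> would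
    force \<open>g (N + 2) = 0\<close>, whose degree is at least 2.\<close>
  have "g 1 \<noteq> 0"
  proof
    assume "g 1 = 0"
    then have zero: "reversible_map.symmetric_at (henon_map [:\<delta>:] (poly f))
      (skew_swap [:\<delta>:]) (pair_cong (I 0)) (a, b) 1" by (simp add: symmetric_iff)
    have "g (1 + Suc N * 1) = 0"
      using reversible_map.symmetric_at_shift[OF reversible zero, of 1 "Suc N"] zero
      unfolding symmetric_iff by simp
    then show False using deg_G[of "Suc N"] deg_g[of "Suc (Suc N)"] by simp
  qed
  define q where "q u = [:- u, 1:] ^ Suc (order u (g 1))" for u
  have "\<not> q u dvd g 1" for u
    unfolding q_def using \<open>g 1 \<noteq> 0\<close> by (simp add: order_divides del: power_Suc)
  then have "\<forall>u. \<exists>r>0. \<forall>k. \<not> q u dvd g (1 + k * r)"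
    using progression by blast
  then obtain r where r: "\<And>u. r u > 0" "\<And>u k. \<not> q u dvd g (1 + k * r u)"
    by metis
  \<comment> \<open>Finiteness enters here: the product is a common multiple of all
    \<open>r u\<close> with \<open>u\<close> periodic.\<close>
  define R where "R = (\<Prod>u\<in>periodic_parameters \<delta> f a b. r u)"
  have "R > 0" unfolding R_def using r(1) by (simp add: prod_pos)
  have bound: "Polynomial.degree (g (1 + k * R)) \<le> Polynomial.degree (g 1)" for k
  proof (cases "g (1 + k * R) = 0")
    case False
    have "order u (g (1 + k * R)) \<le> order u (g 1)" for u
    proof (cases "u \<in> periodic_parameters \<delta> f a b")
      case True
      then have "r u dvd R" unfolding R_def using fin by (intro dvd_prodI)
      then obtain j where "R = j * r u" by (metis dvdE mult.commute)
      then have "\<not> q u dvd g (1 + k * R)"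
        using r(2)[of u "k * j"] by (simp add: mult.assoc)
      then show ?thesis
        using False unfolding q_def by (simp add: order_divides del: power_Suc)
    next
      case not_periodic: False
      \<comment> \<open>The index is at least 1, so a root would be a periodic parameter; hence the
        order at \<open>u\<close> is 0.\<close>
      then have "poly (g (1 + k * R)) u \<noteq> 0" using root_periodic by fastforce
      then show ?thesis by (simp add: order_0I)
    qed
    then show ?thesis using False \<open>g 1 \<noteq> 0\<close> by (intro degree_le_if_order_le)
  qed simp
  \<comment> \<open>A multiple of \<open>R\<close>, so that \<open>bound\<close> applies, and large
    enough for \<open>deg_G\<close> to give a degree above that of \<open>g 1\<close>.\<close>
  define m where "m = (N + Polynomial.degree (g 1)) * R"
  have "m \<ge> N + Polynomial.degree (g 1)" unfolding m_def using \<open>R > 0\<close> by simp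
  moreover from this have "Suc m - N \<le> Polynomial.degree (g (1 + m))"
    using deg_G[of m] by (simp add: deg_g)
  moreover have "Polynomial.degree (g (1 + m)) \<le> Polynomial.degree (g 1)"
    unfolding m_def by (rule bound)
  ultimately show False by linarith
qed

end
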